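(* Let $\eta_{\ell,W}\ge 0$ be the power-constraint (KKT) multiplier associated with the exact transmit update $\underline{\bm V}_W$, so that $(\bm L_\ell+\eta_{\ell,W}\bm I_{N_t})\bm V_{W,\ell k}=\bm\Lambda_{\ell k}$ for all $k$, and $\eta_{\ell,W}\big(\sum_{k}\|\bm V_{W,\ell k}\|_F^2-P_\ell\big)=0$. Suppose that $0\le r\le N_t-1$, $\mathcal G_W>0$, and $\lambda_{\ell,N_t}+\eta_{\ell,W}>0$. Then $$\frac{\mathcal G_{S,r}}{\mathcal G_W}\ \ge\ \left[1-\frac{\lambda_{\ell,r+1}-\lambda_{\ell,N_t}}{\lambda_{\ell,N_t}+\eta_{\ell,W}}\right]_+ .$$
   Context: Fix integers $L,K,N_t,N_r,d\ge1$ and a cell (base station) index $\ell\in\{1,\dots,L\}$. Given are channels $\bm H_{ij,\ell}\in\mathbb C^{N_r\times N_t}$ and weights $w_{ij}\ge0$ for $1\le i\le L$, $1\le j\le K$, a power budget $P_\ell\ge0$, and fixed auxiliary variables $\bm Y_{ij}\in\mathbb C^{N_r\times d}$ and Hermitian positive semidefinite $\bm\Gamma_{ij}\in\mathbb C^{d\times d}$ (in the algorithm these are computed from current beamformers; here they are held fixed). Define $$\bm\Lambda_{\ell k}=w_{\ell k}\bm H_{\ell k,\ell}^H\bm Y_{\ell k}(\bm I_d+\bm\Gamma_{\ell k})\in\mathbb C^{N_t\times d},\qquad \bm L_\ell=\sum_{i=1}^{L}\sum_{j=1}^{K}w_{ij}\bm H_{ij,\ell}^H\bm Y_{ij}(\bm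 I_d+\bm\Gamma_{ij})\bm Y_{ij}^H\bm H_{ij,\ell},$$ so $\bm L_\ell$ is Hermitian positive semidefinite. Let $\bm L_\ell=\bm U_\ell\,\mathrm{diag}(\lambda_{\ell,1},\dots,\lambda_{\ell,N_t})\bm U_\ell^H$ be an eigendecomposition with $\bm U_\ell$ unitary and $\lambda_{\ell,1}\ge\cdots\ge\lambda_{\ell,N_t}\ge0$. For $0\le r\le N_t-1$ the rank-$r$ spectral majorizer is $$\bm K_{\ell,r}=\bm U_\ell\,\mathrm{diag}(\lambda_{\ell,1},\dots,\lambda_{\ell,r},\underbrace{\lambda_{\ell,r+1},\dots,\lambda_{\ell,r+1}}_{N_t-r})\bm U_\ell^H .$$ The feasible set is $\mathcal C=\{\underline{\bm V}=(\bm V_{\ell k})_{k=1}^K:\bm V_{\ell k}\in\mathbb C^{N_t\times d},\ \sum_{k=1}^K\|\bm V_{\ell k}\|_F^2\le P_\ell\}$, and $\underline{\bm V}^{(t)}=(\bm V^{(t)}_{\ell k})_{k}\in\mathcal C$ is a given current point. Up to additive constants independent of $\underline{\bm V}$, the cell-wise transmit objective is $$f_q(\underline{\bm V})=\sum_{k=1}^K\big[2\operatorname{Re}\operatorname{tr}(\bm V_{\ell k}^H\bm\Lambda_{\ell k})-\operatorname{tr}(\bm V_{\ell k}^H\bm L_\ell\bm V_{\ell k})\big],$$ and the rank-$r$ surrogate at the current point is $$f_{s,r}(\underline{\bm V}\mid\underline{\bm V}^{(t)})=\sum_{k=1}^K\big[2\operatorname{Re}\operatorname{tr}(\bm V_{\ell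 k}^H\bm B^{(r)}_{\ell k})-\operatorname{tr}(\bm V_{\ell k}^H\bm K_{\ell,r}\bm V_{\ell k})\big]+\mathrm{const},\qquad \bm B^{(r)}_{\ell k}=\bm\Lambda_{\ell k}+(\bm K_{\ell,r}-\bm L_\ell)\bm V^{(t)}_{\ell k},$$ where the constant is independent of $\underline{\bm V}$ (chosen so that $f_{s,r}=f_q$ at $\underline{\bm V}^{(t)}$). The exact (WMMSE) update is $\underline{\bm V}_W\in\arg\max_{\underline{\bm V}\in\mathcal C}f_q(\underline{\bm V})$ and the rank-$r$ Spectral-NFP update is $\underline{\bm V}_{S,r}\in\arg\max_{\underline{\bm V}\in\mathcal C}f_{s,r}(\underline{\bm V}\mid\underline{\bm V}^{(t)})$. The one-step gains are $$\mathcal G_W=f_q(\underline{\bm V}_W)-f_q(\underline{\bm V}^{(t)}),\qquad \mathcal G_{S,r}=f_{s,r}(\underline{\bm V}_{S,r}\mid\underline{\bm V}^{(t)})-f_{s,r}(\underline{\bm V}^{(t)}\mid\underline{\bm V}^{(t)}).$$ Notation: $[x]_+=\max\{x,0\}$. *)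

theory Defs
  imports "HOL-Analysis.Analysis"
begin

text \<open>
  An \<open>m \<times> n\<close> complex matrix has type \<open>complex^'n^'m\<close> (rows are indexed by \<open>'m\<close>). On this type
  \<open>norm\<close> is the square root of the sum of the squared moduli of the entries, i.e. the Frobenius norm.
\<close>

definition hermitian_transpose :: "complex^'n^'m \<Rightarrow> complex^'m^'n"  (\<open>_\<^sup>H\<close> [1000] 999)
  where "A\<^sup>H = (\<chi> i j. cnj (A $ j $ i))"

definition hermitian :: "complex^'n^'n \<Rightarrow> bool"
  where "hermitian A \<longleftrightarrow> A\<^sup>H = A"

text \<open>For Hermitian \<open>A\<close> the number \<open>x\<^sup>H A x\<close> is real, so taking its real part loses nothing.\<close>

definition hermitian_psd :: "complex^'n^'n \<Rightarrow> bool"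
  where "hermitian_psd A \<longleftrightarrow>
    hermitian A \<and> (\<forall>x :: complex^'n. 0 \<le> Re (\<Sum>i\<in>UNIV. cnj (x $ i) * (A *v x) $ i))"

definition unitary :: "complex^'n^'n \<Rightarrow> bool"
  where "unitary U \<longleftrightarrow> U\<^sup>H ** U = mat 1 \<and> U ** U\<^sup>H = mat 1"

definition real_diag :: "('n \<Rightarrow> real) \<Rightarrow> complex^'n^'n"
  where "real_diag a = (\<chi> i j. if i = j then complex_of_real (a i) else 0)"

text \<open>
  Index conventions: \<open>H i j l\<close> is the channel \<open>H\<^bsub>ij,l\<^esub>\<close>; cells \<open>i\<close> range over \<open>{1..L}\<close> and users \<open>j\<close>
  over \<open>{1..K}\<close>.
\<close>

definition Lambda_mat ::
  "(nat \<Rightarrow> nat \<Rightarrow> real) \<Rightarrow> (nat \<Rightarrow> nat \<Rightarrow> nat \<Rightarrow> complex^'nt^'nr) \<Rightarrow>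
   (nat \<Rightarrow> nat \<Rightarrow> complex^'d^'nr) \<Rightarrow> (nat \<Rightarrow> nat \<Rightarrow> complex^'d^'d) \<Rightarrow>
   nat \<Rightarrow> nat \<Rightarrow> complex^'d^'nt"
  where "Lambda_mat w H Y \<Gamma> l k =
    w l k *\<^sub>R ((H l k l)\<^sup>H ** Y l k ** (mat 1 + \<Gamma> l k))"

definition L_mat ::
  "nat \<Rightarrow> nat \<Rightarrow> (nat \<Rightarrow> nat \<Rightarrow> real) \<Rightarrow> (nat \<Rightarrow> nat \<Rightarrow> nat \<Rightarrow> complex^'nt^'nr) \<Rightarrow>
   (nat \<Rightarrow> nat \<Rightarrow> complex^'d^'nr) \<Rightarrow> (nat \<Rightarrow> nat \<Rightarrow> complex^'d^'d) \<Rightarrow>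
   nat \<Rightarrow> complex^'nt^'nt"
  where "L_mat L K w H Y \<Gamma> l =
    (\<Sum>i=1..L. \<Sum>j=1..K.
       w i j *\<^sub>R ((H i j l)\<^sup>H ** Y i j ** (mat 1 + \<Gamma> i j) ** (Y i j)\<^sup>H ** H i j l))"

text \<open>
  The finite type \<open>'n\<close> carries no order, so a bijection \<open>e\<close> from \<open>'n\<close> onto \<open>{1..CARD('n)}\<close> records
  which column of \<open>U\<close> belongs to the \<open>i\<close>-th largest eigenvalue \<open>lam i\<close>.
\<close>

definition ordered_eigendecomposition ::
  "complex^'n^'n \<Rightarrow> complex^'n^'n \<Rightarrow> ('n \<Rightarrow> nat) \<Rightarrow> (nat \<Rightarrow> real) \<Rightarrow> bool"
  where "ordered_eigendecomposition A U e lam \<longleftrightarrow>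
    bij_betw e UNIV {1..CARD('n)} \<and> unitary U \<and>
    A = U ** real_diag (\<lambda>c. lam (e c)) ** U\<^sup>H \<and>
    antimono_on {1..CARD('n)} lam \<and> 0 \<le> lam CARD('n)"

definition spectral_majorizer ::
  "complex^'n^'n \<Rightarrow> ('n \<Rightarrow> nat) \<Rightarrow> (nat \<Rightarrow> real) \<Rightarrow> nat \<Rightarrow> complex^'n^'n"
  where "spectral_majorizer U e lam r =
    U ** real_diag (\<lambda>c. if e c \<le> r then lam (e c) else lam (r + 1)) ** U\<^sup>H"

text \<open>
  A beamformer tuple is a function on \<open>nat\<close> of which only the values on \<open>{1..K}\<close> matter.
\<close>

definition feasible :: "nat \<Rightarrow> real \<Rightarrow> (nat \<Rightarrow> complex^'d^'nt) set"
  where "feasible K P = {V. (\<Sum>k=1..K. (norm (V k))\<^sup>2) \<le> P}"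

text \<open>
  In the quadratic term the matrix \<open>M\<close> is always Hermitian, so the trace is real.
\<close>

definition quad_objective ::
  "nat \<Rightarrow> (nat \<Rightarrow> complex^'d^'nt) \<Rightarrow> complex^'nt^'nt \<Rightarrow> (nat \<Rightarrow> complex^'d^'nt) \<Rightarrow> real"
  where "quad_objective K B M V =
    (\<Sum>k=1..K. 2 * Re (trace ((V k)\<^sup>H ** B k)) - Re (trace ((V k)\<^sup>H ** M ** V k)))"

text \<open>
  Surrogate of \<open>quad_objective K \<Lambda> A\<close> at \<open>Vt\<close> with majorizer \<open>M\<close>. The last two terms are the additive
  constant that makes both functions agree at \<open>Vt\<close>.
\<close>

definition surrogate ::
  "nat \<Rightarrow> (nat \<Rightarrow> complex^'d^'nt) \<Rightarrow> complex^'nt^'nt \<Rightarrow> complex^'nt^'nt \<Rightarrow>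
   (nat \<Rightarrow> complex^'d^'nt) \<Rightarrow> (nat \<Rightarrow> complex^'d^'nt) \<Rightarrow> real"
  where "surrogate K \<Lambda> A M Vt V =
    (let B = (\<lambda>k. \<Lambda> k + (M - A) ** Vt k)
     in quad_objective K B M V + (quad_objective K \<Lambda> A Vt - quad_objective K B M Vt))"

end

theory Submission
  imports Defs
begin

text \<open>
  Write \<open>D = VW - Vt\<close>. Since \<open>fs V = fq V - \<langle>V - Vt, (Kr - Lm) (V - Vt)\<rangle>\<close> and
  \<open>Kr - Lm\<close> is bounded above by \<open>\<delta> I\<close> with \<open>\<delta> = \<lambda>\<^bsub>r+1\<^esub> - \<lambda>\<^bsub>N\<^esub>\<close>, testing the surrogate at the exact
  update \<open>VW\<close> gives \<open>GS \<ge> GW - \<delta> \<parallel>D\<parallel>\<^sup>2\<close>. The KKT conditions turn the gain into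
  \<open>GW = 2\<eta> \<langle>D, VW\<rangle> + \<langle>D, Lm D\<rangle>\<close>, and complementary slackness with feasibility of \<open>Vt\<close> gives
  \<open>2\<eta> \<langle>D, VW\<rangle> \<ge> \<eta> \<parallel>D\<parallel>\<^sup>2\<close>, so \<open>GW \<ge> (\<lambda>\<^bsub>N\<^esub> + \<eta>) \<parallel>D\<parallel>\<^sup>2\<close>.
  Testing the surrogate at \<open>Vt\<close> itself gives \<open>GS \<ge> 0\<close>.
\<close>

lemma hermitian_transpose_transpose [simp]: "(A\<^sup>H)\<^sup>H = A"
  by (simp add: hermitian_transpose_def vec_eq_iff)

lemma hermitian_transpose_mult: "(A ** B)\<^sup>H = B\<^sup>H ** A\<^sup>H"
  by (simp add: hermitian_transpose_def matrix_matrix_mult_def vec_eq_iff mult.commute)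

lemma hermitian_transpose_real_diag [simp]: "(real_diag a)\<^sup>H = real_diag a"
  by (simp add: hermitian_transpose_def real_diag_def vec_eq_iff)

text \<open>This places the whole argument in the real inner product space of matrices. The trace
  sums over columns first and the inner product over rows first, hence the swap.\<close>

lemma Re_trace_hermitian_transpose_mult:
  fixes X Y :: "complex^'n^'m"
  shows "Re (trace (X\<^sup>H ** Y)) = X \<bullet> Y"
proof -
  have "Re (trace (X\<^sup>H ** Y)) = (\<Sum>i\<in>UNIV. \<Sum>j\<in>UNIV. X $ j $ i \<bullet> Y $ j $ i)"
    by (simp add: trace_def hermitian_transpose_def matrix_matrix_mult_def inner_complex_def)
  also have "\<dots> = X \<bullet> Y"
    unfolding inner_vec_def by (rule sum.swap)
  finally show ?thesis .
qed

lemma inner_matrix_mult_right: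
  fixes A :: "complex^'n^'m"
  shows "X \<bullet> (A ** Y) = (A\<^sup>H ** X) \<bullet> Y"
  by (simp add: Re_trace_hermitian_transpose_mult [symmetric] hermitian_transpose_mult matrix_mul_assoc)

lemma inner_hermitian_commute:
  assumes "hermitian A"
  shows "X \<bullet> (A ** Y) = Y \<bullet> (A ** X)"
  using assms by (metis hermitian_def inner_commute inner_matrix_mult_right)

lemma hermitian_conj_real_diag: "hermitian (U ** real_diag a ** U\<^sup>H)"
  by (simp add: hermitian_def hermitian_transpose_mult matrix_mul_assoc)

lemma matrix_mult_diff_left:
  fixes A B :: "'a::ring_1^'n^'m"
  shows "(A - B) ** C = A ** C - B ** C"
  by (simp add: matrix_matrix_mult_def vec_eq_iff left_diff_distrib sum_subtractf)

lemma matrix_mult_diff_right: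
  fixes A :: "'a::ring_1^'n^'m"
  shows "A ** (B - C) = A ** B - A ** C"
  by (simp add: matrix_matrix_mult_def vec_eq_iff right_diff_distrib sum_subtractf)

lemma matrix_add_scaleR_mat_1_mult:
  fixes A :: "'a::real_algebra_1^'n^'n"
  shows "(A + c *\<^sub>R mat 1) ** X = A ** X + c *\<^sub>R X"
  by (simp add: matrix_matrix_mult_def mat_def vec_eq_iff distrib_right sum.distrib
      if_distrib [of "\<lambda>x. x * _"] if_distrib [of "(*\<^sub>R) _"] cong: if_cong)

lemma real_diag_diff: "real_diag a - real_diag b = real_diag (\<lambda>c. a c - b c)"
  by (simp add: real_diag_def vec_eq_iff)

lemma inner_real_diag_mult:
  "X \<bullet> (real_diag a ** X) = (\<Sum>c\<in>UNIV. a c * (norm (X $ c))\<^sup>2)"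
proof -
  have "(real_diag a ** X) $ c = a c *\<^sub>R X $ c" for c
    by (simp add: matrix_matrix_mult_def real_diag_def vec_eq_iff if_distrib [of "\<lambda>x. x * _"]
        scaleR_conv_of_real [where 'a = complex] cong: if_cong)
  then show ?thesis
    by (simp add: inner_vec_def [of X] power2_norm_eq_inner)
qed

text \<open>Moving \<open>U\<close> across the inner product diagonalises the form: in the
  coordinates \<open>U\<^sup>H ** X\<close>, each row is weighted by its own eigenvalue.\<close>

lemma inner_conj_real_diag:
  "X \<bullet> (U ** real_diag a ** U\<^sup>H ** X) = (\<Sum>c\<in>UNIV. a c * (norm ((U\<^sup>H ** X) $ c))\<^sup>2)"
  unfolding inner_real_diag_mult [symmetric]
  by (simp add: inner_matrix_mult_right [of X U] matrix_mul_assoc [symmetric])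

lemma norm_unitary_mult:
  fixes X :: "complex^'n^'m"
  assumes "unitary U"
  shows "(\<Sum>c\<in>UNIV. (norm ((U\<^sup>H ** X) $ c))\<^sup>2) = (norm X)\<^sup>2"
proof -
  have "(U\<^sup>H ** X) \<bullet> (U\<^sup>H ** X) = X \<bullet> X"
    using assms
    by (simp add: inner_matrix_mult_right [of _ "U\<^sup>H"] matrix_mul_assoc unitary_def)
  then show ?thesis
    by (simp add: power2_norm_eq_inner inner_vec_def [of "U\<^sup>H ** X"])
qed

lemma inner_conj_real_diag_le:
  assumes "unitary U" and "\<And>c. a c \<le> b"
  shows "X \<bullet> (U ** real_diag a ** U\<^sup>H ** X) \<le> b * (norm X)\<^sup>2"
  unfolding inner_conj_real_diag norm_unitary_mult [OF assms(1), symmetric] sum_distrib_left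
  by (intro sum_mono mult_right_mono assms) simp

lemma inner_conj_real_diag_ge:
  assumes "unitary U" and "\<And>c. b \<le> a c"
  shows "b * (norm X)\<^sup>2 \<le> X \<bullet> (U ** real_diag a ** U\<^sup>H ** X)"
  unfolding inner_conj_real_diag norm_unitary_mult [OF assms(1), symmetric] sum_distrib_left
  by (intro sum_mono mult_right_mono assms) simp

lemma quad_objective_eq_inner:
  "quad_objective K B M V = (\<Sum>k=1..K. 2 * (V k \<bullet> B k) - V k \<bullet> (M ** V k))"
  by (simp add: quad_objective_def Re_trace_hermitian_transpose_mult matrix_mul_assoc [symmetric])

text \<open>Exact second-order expansion about \<open>V\<close>, not \<open>W\<close>, which is why
  the quadratic term carries a plus sign. It is applied with \<open>V\<close> the exact update,
  where the KKT conditions determine \<open>B k - M ** V k\<close>.\<close>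

lemma quad_objective_diff:
  assumes "hermitian M"
  shows "quad_objective K B M V - quad_objective K B M W =
    (\<Sum>k=1..K. 2 * ((V k - W k) \<bullet> (B k - M ** V k)) + (V k - W k) \<bullet> (M ** (V k - W k)))"
  unfolding quad_objective_eq_inner sum_subtractf [symmetric]
  by (rule sum.cong)
    (simp_all add: inner_hermitian_commute [OF assms, of "W _" "V _"] matrix_mult_diff_right
      inner_diff algebra_simps)

text \<open>The shift \<open>(M - A) ** T k\<close> of the linear coefficient cancels every term of
  first order in \<open>V k - T k\<close>, and the additive constant cancels those of order
  zero.\<close>

lemma surrogate_eq:
  assumes "hermitian A" and "hermitian M"
  shows "surrogate K B A M T V =
    quad_objective K B A V - (\<Sum>k=1..K. (V k - T k) \<bullet> ((M - A) ** (V k - T k)))"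
  unfolding surrogate_def Let_def quad_objective_eq_inner
    sum_subtractf [symmetric] sum.distrib [symmetric]
  by (rule sum.cong)
    (simp_all add: inner_hermitian_commute [OF assms(1), of "T _" "V _"]
      inner_hermitian_commute [OF assms(2), of "T _" "V _"] matrix_mult_diff_right
      matrix_mult_diff_left inner_diff inner_add algebra_simps)

lemma conj_real_diag_diff:
  "U ** real_diag a ** U\<^sup>H - U ** real_diag b ** U\<^sup>H = U ** real_diag (\<lambda>c. a c - b c) ** U\<^sup>H"
  by (simp add: real_diag_diff [symmetric] matrix_mult_diff_left matrix_mult_diff_right)

theorem theorem1:
  fixes L K l r :: nat
    and H :: "nat \<Rightarrow> nat \<Rightarrow> nat \<Rightarrow> complex^'nt^'nr"
    and w :: "nat \<Rightarrow> nat \<Rightarrow> real"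
    and P :: real
    and Y :: "nat \<Rightarrow> nat \<Rightarrow> complex^'d^'nr"
    and \<Gamma> :: "nat \<Rightarrow> nat \<Rightarrow> complex^'d^'d"
    and U Lm Kr :: "complex^'nt^'nt"
    and e :: "'nt \<Rightarrow> nat"
    and lam :: "nat \<Rightarrow> real"
    and \<Lambda> Vt VW VS :: "nat \<Rightarrow> complex^'d^'nt"
    and fq fs :: "(nat \<Rightarrow> complex^'d^'nt) \<Rightarrow> real"
    and \<eta> GW GS :: real
  assumes "1 \<le> L" and "1 \<le> K" and "l \<in> {1..L}"
    and "\<forall>i\<in>{1..L}. \<forall>j\<in>{1..K}. 0 \<le> w i j"
    and "0 \<le> P"
    and "\<forall>i\<in>{1..L}. \<forall>j\<in>{1..K}. hermitian_psd (\<Gamma> i j)"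
    and \<Lambda>: "\<Lambda> = Lambda_mat w H Y \<Gamma> l"
    and Lm: "Lm = L_mat L K w H Y \<Gamma> l"
    and "ordered_eigendecomposition Lm U e lam"
    and "r \<le> CARD('nt) - 1"
    and Kr: "Kr = spectral_majorizer U e lam r"
    and "Vt \<in> feasible K P"
    and fq: "fq = quad_objective K \<Lambda> Lm"
    and fs: "fs = surrogate K \<Lambda> Lm Kr Vt"
    and "is_arg_max fq (\<lambda>V. V \<in> feasible K P) VW"
    and "is_arg_max fs (\<lambda>V. V \<in> feasible K P) VS"
    and GW: "GW = fq VW - fq Vt"
    and GS: "GS = fs VS - fs Vt"
    and "0 \<le> \<eta>"
    and "\<forall>k\<in>{1..K}. (Lm + \<eta> *\<^sub>R mat 1) ** VW k = \<Lambda> k"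
    and "\<eta> * ((\<Sum>k=1..K. (norm (VW k))\<^sup>2) - P) = 0"
    and "0 < GW"
    and "0 < lam CARD('nt) + \<eta>"
  shows "GS / GW \<ge> max 0 (1 - (lam (r + 1) - lam CARD('nt)) / (lam CARD('nt) + \<eta>))"
proof -
  let ?n = "CARD('nt)"
  define D where "D k = VW k - Vt k" for k
  define S where "S = (\<Sum>k=1..K. (norm (D k))\<^sup>2)"
  define m where "m = lam ?n + \<eta>"
  define \<delta> where "\<delta> = lam (r + 1) - lam ?n"
  have e: "e c \<in> {1..?n}" for c
    using assms(9) by (auto simp: ordered_eigendecomposition_def bij_betw_def)
  have U: "unitary U" and Lm_eq: "Lm = U ** real_diag (\<lambda>c. lam (e c)) ** U\<^sup>H"
    and mono: "antimono_on {1..?n} lam"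
    using assms(9) by (auto simp: ordered_eigendecomposition_def)
  have lam_ge: "lam ?n \<le> lam i" if "i \<in> {1..?n}" for i
    using monotone_onD [OF mono that, of ?n] that by auto
  \<comment> \<open>Subtraction on naturals is truncated, so \<open>r \<le> ?n - 1\<close> yields
    this only because \<open>?n\<close> is positive.\<close>
  have r: "r + 1 \<in> {1..?n}"
  proof -
    have "0 < ?n" by simp
    then have "r + 1 \<le> ?n" using assms(10) by linarith
    then show ?thesis by simp
  qed
  have \<delta>: "0 \<le> \<delta>"
    using lam_ge [OF r] by (simp add: \<delta>_def)
  have hL: "hermitian Lm" and hK: "hermitian Kr"
    by (simp_all add: Lm_eq Kr spectral_majorizer_def hermitian_conj_real_diag)
  \<comment> \<open>Both matrices are diagonal in the basis \<open>U\<close>. The eigenvalues of the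
    difference are 0 where \<open>e c \<le> r\<close> and \<open>lam (r + 1) - lam (e c)\<close>
    elsewhere; the first case needs \<open>0 \<le> \<delta>\<close>.\<close>
  have KL: "X \<bullet> ((Kr - Lm) ** X) \<le> \<delta> * (norm X)\<^sup>2" for X :: "complex^'d^'nt"
    unfolding Kr spectral_majorizer_def Lm_eq conj_real_diag_diff
    by (rule inner_conj_real_diag_le [OF U]) (use e lam_ge \<delta> in \<open>auto simp: \<delta>_def\<close>)
  have LL: "lam ?n * (norm X)\<^sup>2 \<le> X \<bullet> (Lm ** X)" for X :: "complex^'d^'nt"
    unfolding Lm_eq by (rule inner_conj_real_diag_ge [OF U]) (rule lam_ge [OF e])
  have fs_eq: "fs V = fq V - (\<Sum>k=1..K. (V k - Vt k) \<bullet> ((Kr - Lm) ** (V k - Vt k)))" for V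
    by (simp add: fs fq surrogate_eq [OF hL hK])

  have fs_Vt: "fs Vt = fq Vt"
    by (simp add: fs_eq)
  have "fs Vt \<le> fs VS" "fs VW \<le> fs VS"
    using assms(12,15,16) by (auto simp: is_arg_max_linorder)
  then have GS0: "0 \<le> GS" and GS1: "fs VW - fs Vt \<le> GS"
    by (simp_all add: GS)
  have "(\<Sum>k=1..K. D k \<bullet> ((Kr - Lm) ** D k)) \<le> \<delta> * S"
    unfolding S_def sum_distrib_left by (intro sum_mono KL)
  then have GS2: "GW - \<delta> * S \<le> GS"
    using GS1 fs_Vt by (simp add: fs_eq [of VW] GW D_def)

  have grad: "\<Lambda> k - Lm ** VW k = \<eta> *\<^sub>R VW k" if "k \<in> {1..K}" for k
  proof -
    have "\<Lambda> k = (Lm + \<eta> *\<^sub>R mat 1) ** VW k"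
      using assms(20) that by simp
    also have "\<dots> = Lm ** VW k + \<eta> *\<^sub>R VW k"
      by (rule matrix_add_scaleR_mat_1_mult)
    finally show ?thesis by simp
  qed
  \<comment> \<open>Complementary slackness turns the first weighted sum into
    \<open>\<eta> * P\<close>, which bounds the second because \<open>Vt\<close> is
    feasible.\<close>
  have slack: "0 \<le> \<eta> * ((\<Sum>k=1..K. (norm (VW k))\<^sup>2) - (\<Sum>k=1..K. (norm (Vt k))\<^sup>2))"
  proof -
    have "\<eta> * (\<Sum>k=1..K. (norm (Vt k))\<^sup>2) \<le> \<eta> * P"
      using assms(12,19) by (intro mult_left_mono) (auto simp: feasible_def)
    then show ?thesis
      using assms(21) by (auto simp: right_diff_distrib)
  qed
  have "m * S \<le> (\<Sum>k=1..K. \<eta> * (norm (D k))\<^sup>2 + D k \<bullet> (Lm ** D k))"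
    unfolding m_def S_def sum_distrib_left
    by (intro sum_mono) (use LL in \<open>simp add: distrib_right\<close>)
  also have "\<dots> \<le> (\<Sum>k=1..K. \<eta> * (norm (D k))\<^sup>2 + D k \<bullet> (Lm ** D k)) +
      \<eta> * ((\<Sum>k=1..K. (norm (VW k))\<^sup>2) - (\<Sum>k=1..K. (norm (Vt k))\<^sup>2))"
    using slack by simp
  \<comment> \<open>Polarisation: \<open>2 * (D k \<bullet> VW k)\<close> equals the squared norm of
    \<open>D k\<close> plus that of \<open>VW k\<close> minus that of \<open>Vt k\<close>.\<close>
  also have "\<dots> = (\<Sum>k=1..K. 2 * (D k \<bullet> (\<eta> *\<^sub>R VW k)) + D k \<bullet> (Lm ** D k))"
    unfolding sum_subtractf [symmetric] sum_distrib_left sum.distrib [symmetric]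
    by (rule sum.cong)
      (simp_all add: D_def power2_norm_eq_inner inner_diff inner_commute [of "Vt _" "VW _"]
        algebra_simps)
  also have "\<dots> = GW"
    unfolding GW fq quad_objective_diff [OF hL] by (simp add: grad D_def)
  finally have GW_ge: "m * S \<le> GW" .

  have m: "0 < m"
    using assms(23) by (simp add: m_def)
  have "\<delta> * S \<le> \<delta> * (GW / m)"
    using GW_ge m \<delta> by (intro mult_left_mono) (auto simp: field_simps)
  then have "GW * (1 - \<delta> / m) \<le> GS"
    using GS2 by (simp add: algebra_simps)
  then have "1 - \<delta> / m \<le> GS / GW"
    using assms(22) by (simp add: field_simps)
  \<comment> \<open>The branch 0 of the maximum is covered by \<open>0 \<le> GS\<close> and
    \<open>0 < GW\<close>.\<close>
  then show ?thesis
    using GS0 assms(22) by (simp add: \<delta>_def m_def)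
qed

end
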